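(* Let $\mathcal F\subseteq 2^{[n]}$ be a finite union-closed family with $N=|\mathcal F|\ge 2$. Let $\mathcal C$ be the set of probability distributions on $\mathcal F^2$ both of whose marginals are uniform on $\mathcal F$, and let $Q(A,B)=\frac{1}{N\,r(A\cup B)}$ for $A,B\in\mathcal F$. Then the minimizer $P_*$ of $D(P\Vert Q)$ over $P\in\mathcal C$ exists, is unique and strictly positive (i.e. $P_*(A,B)>0$ for all $A,B\in\mathcal F$), and has the form $$P_*(A,B)=\frac{a(A)a(B)}{r(A\cup B)}\qquad(A,B\in\mathcal F)$$ for positive factors $a(A)$, $A\in\mathcal F$, chosen to make every row and column sum of $P_*$ equal to $1/N$.
   Context: A family $\mathcal F\subseteq 2^{[n]}$, $[n]=\{1,\dots,n\}$, is union-closed if $A\cup B\in\mathcal F$ whenever $A,B\in\mathcal F$. For $S\in\mathcal F$, $r(S)=|\{(A,B)\in\mathcal F^2: A\cup B=S\}|$ is the number of ordered pairs with union $S$ ($r(S)\ge1$ since $(S,S)$ is such a pair); consequently $Q$ is a strictly positive probability distribution on $\mathcal F^2$. For probability distributions $P,Q$ on a finite set with $Q>0$ everywhere, $D(P\Vert Q)=\sum_\omega P(\omega)\ln\frac{P(\omega)}{Q(\omega)}$ (natural logarithm), with zero summand when $P(\omega)=0$. *)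

theory Defs
  imports "HOL-Probability.Probability_Mass_Function"
begin

definition union_closed :: "'a set set \<Rightarrow> bool" where
  "union_closed \<F> \<longleftrightarrow> (\<forall>A\<in>\<F>. \<forall>B\<in>\<F>. A \<union> B \<in> \<F>)"

definition reps :: "'a set set \<Rightarrow> 'a set \<Rightarrow> nat" where
  "reps \<F> S = card {(A, B). A \<in> \<F> \<and> B \<in> \<F> \<and> A \<union> B = S}"

text \<open>
  Probability distributions on a set \<open>\<Omega>\<close> are rendered as probability mass functions whose
  support is contained in \<open>\<Omega>\<close>.
\<close>

definition uniform_couplings :: "'a set \<Rightarrow> ('a \<times> 'a) pmf set" where
  "uniform_couplings \<F> =
     {P. set_pmf P \<subseteq> \<F> \<times> \<F> \<and> map_pmf fst P = pmf_of_set \<F> \<and> map_pmf snd P = pmf_of_set \<F>}"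

text \<open>
  The reference distribution \<open>Q\<close>. The argument of \<open>embed_pmf\<close> sums to 1 when \<open>\<F>\<close> is finite,
  nonempty and union-closed, see \<open>pmf_union_ref\<close> below.
\<close>

definition union_ref :: "'a set set \<Rightarrow> ('a set \<times> 'a set) pmf" where
  "union_ref \<F> = embed_pmf (\<lambda>(A, B).
     if A \<in> \<F> \<and> B \<in> \<F> then 1 / (real (card \<F>) * real (reps \<F> (A \<union> B))) else 0)"

definition rel_entropy :: "'a set \<Rightarrow> 'a pmf \<Rightarrow> 'a pmf \<Rightarrow> real" where
  "rel_entropy \<Omega> P Q =
     (\<Sum>\<omega>\<in>\<Omega>. if pmf P \<omega> = 0 then 0 else pmf P \<omega> * ln (pmf P \<omega> / pmf Q \<omega>))"

lemma reps_pos: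
  assumes "finite \<F>" "S \<in> \<F>"
  shows "reps \<F> S > 0"
proof -
  have "finite {(A, B). A \<in> \<F> \<and> B \<in> \<F> \<and> A \<union> B = S}"
    by (rule finite_subset[of _ "\<F> \<times> \<F>"]) (use assms in auto)
  moreover have "(S, S) \<in> {(A, B). A \<in> \<F> \<and> B \<in> \<F> \<and> A \<union> B = S}"
    using assms by auto
  ultimately show ?thesis
    unfolding reps_def card_gt_0_iff by blast
qed

lemma sum_union_ref:
  assumes fin: "finite \<F>" and "\<F> \<noteq> {}" and uc: "union_closed \<F>"
  shows "(\<Sum>(A, B)\<in>\<F> \<times> \<F>. 1 / (real (card \<F>) * real (reps \<F> (A \<union> B)))) = 1"
proof -
  let ?g = "\<lambda>(A, B). 1 / (real (card \<F>) * real (reps \<F> (A \<union> B)))"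
  let ?u = "\<lambda>(A, B). A \<union> B"
  have "sum ?g (\<F> \<times> \<F>) = (\<Sum>S\<in>\<F>. sum ?g {x \<in> \<F> \<times> \<F>. ?u x = S})"
    by (rule sum.group[symmetric]) (use fin uc in \<open>auto simp: union_closed_def\<close>)
  also have "\<dots> = (\<Sum>S\<in>\<F>. 1 / real (card \<F>))"
  proof (rule sum.cong[OF refl])
    fix S assume S: "S \<in> \<F>"
    have eq: "{x \<in> \<F> \<times> \<F>. ?u x = S} = {(A, B). A \<in> \<F> \<and> B \<in> \<F> \<and> A \<union> B = S}"
      by auto
    have "sum ?g {x \<in> \<F> \<times> \<F>. ?u x = S} =
        (\<Sum>x\<in>{x \<in> \<F> \<times> \<F>. ?u x = S}. 1 / (real (card \<F>) * real (reps \<F> S)))"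
      by (rule sum.cong) auto
    also have "\<dots> = real (reps \<F> S) * (1 / (real (card \<F>) * real (reps \<F> S)))"
      by (simp add: eq reps_def)
    also have "\<dots> = 1 / real (card \<F>)"
      using reps_pos[OF fin S] by simp
    finally show "sum ?g {x \<in> \<F> \<times> \<F>. ?u x = S} = 1 / real (card \<F>)" .
  qed
  also have "\<dots> = 1"
    using assms by simp
  finally show ?thesis .
qed

lemma pmf_union_ref:
  assumes fin: "finite \<F>" and ne: "\<F> \<noteq> {}" and uc: "union_closed \<F>"
  shows "pmf (union_ref \<F>) (A, B) =
    (if A \<in> \<F> \<and> B \<in> \<F> then 1 / (real (card \<F>) * real (reps \<F> (A \<union> B))) else 0)"
proof -
  define f :: "'a set \<times> 'a set \<Rightarrow> real" where "f = (\<lambda>(A, B).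
     if A \<in> \<F> \<and> B \<in> \<F> then 1 / (real (card \<F>) * real (reps \<F> (A \<union> B))) else 0)"
  have nn: "f x \<ge> 0" for x
    by (cases x) (simp add: f_def)
  have out: "f x = 0" if "x \<notin> \<F> \<times> \<F>" for x
    using that by (cases x) (auto simp: f_def)
  have "(\<integral>\<^sup>+ x. ennreal (f x) \<partial>count_space UNIV) = (\<Sum>x\<in>\<F> \<times> \<F>. ennreal (f x))"
    by (rule nn_integral_count_space') (use fin out in simp_all)
  also have "\<dots> = ennreal (\<Sum>x\<in>\<F> \<times> \<F>. f x)"
    by (rule sum_ennreal) (rule nn)
  also have "(\<Sum>x\<in>\<F> \<times> \<F>. f x) =
      (\<Sum>(A, B)\<in>\<F> \<times> \<F>. 1 / (real (card \<F>) * real (reps \<F> (A \<union> B))))"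
    by (rule sum.cong[OF refl]) (simp add: f_def split_beta mem_Times_iff)
  also have "\<dots> = 1"
    by (rule sum_union_ref[OF assms])
  finally have one: "(\<integral>\<^sup>+ x. ennreal (f x) \<partial>count_space UNIV) = 1"
    by simp
  have "pmf (embed_pmf f) (A, B) = f (A, B)"
    by (rule pmf_embed_pmf[OF nn one])
  then show ?thesis
    by (simp add: union_ref_def f_def)
qed

end

theory Submission imports Defs begin

text \<open>
  Everything follows from the existence of the positive factors \<open>a\<close>, which are found without
  looking at couplings at all. The matrix \<open>K(A,B) = 1 / r(A \<union> B)\<close> is symmetric with positive
  entries, and a vector \<open>a > 0\<close> with \<open>a(A) * (\<Sum>B. K(A,B) * a(B)) = 1/N\<close> for all \<open>A\<close> is precisely
  a critical point of
  \[ x \mapsto \frac12 \sum_{A,B} K(A,B)\, x(A)\, x(B) - \frac1N \sum_A \ln x(A) \]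
  on the positive orthant. This function tends to infinity both at the walls of the orthant and
  at infinity, so it has a minimizer (\<open>ex_symmetric_scaling\<close>).

  By symmetry of \<open>K\<close>, the weights \<open>R(A,B) = a(A) * a(B) * K(A,B)\<close> form a coupling of the uniform
  distribution with itself. The quotient \<open>R/Q = N * a(A) * a(B)\<close> is a product of a function of
  \<open>A\<close> and a function of \<open>B\<close>, so the expectation of its logarithm under a coupling \<open>P\<close> depends
  only on the marginals and is the same for all couplings. This gives the Pythagorean identity
  \<open>D(P,Q) = D(P,R) + D(R,Q)\<close> (\<open>rel_entropy_pythagoras\<close>). By Gibbs' inequality \<open>D(P,R) \<ge> 0\<close>,
  with equality only for \<open>P = R\<close>, so \<open>R\<close> is the unique minimizer, and it visibly has the
  required form.
\<close>

section \<open>Scaling a symmetric matrix to prescribed row sums\<close>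

text \<open>
  The potential that will be minimized dominates a sum of functions \<open>k/2 * t\<^sup>2 - c * ln t\<close> of one
  coordinate each. Near \<open>0\<close> such a function is large because of the logarithm, and for large \<open>t\<close>
  because the square outgrows \<open>ln t \<le> t - 1\<close>. A lower bound for all but one of the summands turns
  a bound on the potential into one on the remaining coordinate.
\<close>

lemma quadratic_minus_ln_bounded_below:
  fixes k c :: real
  assumes "k > 0" "c > 0"
  shows "\<exists>m. \<forall>t>0. m \<le> k / 2 * t\<^sup>2 - c * ln t"
proof (intro exI allI impI)
  fix t :: real assume t: "t > 0"
  have "c * ln t \<le> c * t"
    using ln_le_minus_one[OF t] assms by (intro mult_left_mono) auto
  moreover have "0 \<le> k / 2 * (t - c / k)\<^sup>2"
    using assms by simp
  moreover have "k / 2 * (t - c / k)\<^sup>2 = k / 2 * t\<^sup>2 - c * t + c\<^sup>2 / (2 * k)"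
    using assms by (simp add: power2_eq_square field_simps)
  ultimately show "- (c\<^sup>2 / (2 * k)) \<le> k / 2 * t\<^sup>2 - c * ln t"
    by linarith
qed

lemma quadratic_minus_ln_sublevel:
  fixes k c L :: real
  assumes "k > 0" "c > 0"
  shows "\<exists>lo hi. 0 < lo \<and> (\<forall>t>0. k / 2 * t\<^sup>2 - c * ln t \<le> L \<longrightarrow> lo \<le> t \<and> t \<le> hi)"
proof (intro exI conjI allI impI)
  show "0 < exp (- (L / c))" by simp
next
  fix t :: real assume t: "t > 0" and le: "k / 2 * t\<^sup>2 - c * ln t \<le> L"
  have "0 \<le> k / 2 * t\<^sup>2"
    using assms by simp
  with le have "- L \<le> c * ln t"
    by linarith
  then have "- (L / c) \<le> ln t"
    using assms by (simp add: field_simps)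
  then show "exp (- (L / c)) \<le> t"
    using t by (simp add: ln_ge_iff)
  show "t \<le> max L (2 * (c + 1) / k)"
  proof (rule ccontr)
    assume "\<not> ?thesis"
    then have "L < t" and "2 * (c + 1) / k < t"
      by auto
    \<comment> \<open>The threshold makes the quadratic term dominate \<open>(c + 1) * t\<close>, leaving at least \<open>t > L\<close>.\<close>
    then have "c + 1 \<le> k / 2 * t"
      using assms by (simp add: field_simps)
    then have "(c + 1) * t \<le> k / 2 * t * t"
      using t by (intro mult_right_mono) auto
    moreover have "c * ln t \<le> c * t"
      using ln_le_minus_one[OF t] assms by (intro mult_left_mono) auto
    ultimately have "t \<le> k / 2 * t\<^sup>2 - c * ln t"
      by (simp add: power2_eq_square algebra_simps)
    with le \<open>L < t\<close> show False
      by linarith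
  qed
qed

text \<open>
  A quadratic form with a logarithmic barrier: for symmetric \<open>K\<close> and positive \<open>x\<close>, its partial
  derivatives vanish exactly when \<open>x i * (\<Sum>j\<in>I. K i j * x j) = c i\<close> for all \<open>i \<in> I\<close>.
\<close>

definition scaling_potential ::
    "'a set \<Rightarrow> ('a \<Rightarrow> 'a \<Rightarrow> real) \<Rightarrow> ('a \<Rightarrow> real) \<Rightarrow> ('a \<Rightarrow> real) \<Rightarrow> real" where
  "scaling_potential I K c x =
     (\<Sum>i\<in>I. \<Sum>j\<in>I. K i j * x i * x j) / 2 - (\<Sum>i\<in>I. c i * ln (x i))"

text \<open>
  For positive vectors the off-diagonal terms only increase the potential, which is why a
  positive diagonal already gives coercivity.
\<close>

lemma scaling_potential_ge_diagonal:
  assumes fin: "finite I"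
    and nonneg: "\<And>i j. i \<in> I \<Longrightarrow> j \<in> I \<Longrightarrow> K i j \<ge> 0"
    and pos: "\<And>i. i \<in> I \<Longrightarrow> x i > 0"
  shows "(\<Sum>i\<in>I. K i i / 2 * (x i)\<^sup>2 - c i * ln (x i)) \<le> scaling_potential I K c x"
proof -
  have "(\<Sum>i\<in>I. K i i * x i * x i) \<le> (\<Sum>i\<in>I. \<Sum>j\<in>I. K i j * x i * x j)"
  proof (rule sum_mono)
    fix i assume i: "i \<in> I"
    show "K i i * x i * x i \<le> (\<Sum>j\<in>I. K i j * x i * x j)"
      by (rule member_le_sum[OF i _ fin]) (use i nonneg pos in \<open>auto simp: less_imp_le\<close>)
  qed
  moreover have "(\<Sum>i\<in>I. K i i / 2 * (x i)\<^sup>2) = (\<Sum>i\<in>I. K i i * x i * x i) / 2"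
    by (simp add: sum_divide_distrib power2_eq_square mult.assoc)
  ultimately show ?thesis
    by (simp add: scaling_potential_def sum_subtractf)
qed

lemma scaling_potential_attains_min:
  assumes fin: "finite I"
    and nonneg: "\<And>i j. i \<in> I \<Longrightarrow> j \<in> I \<Longrightarrow> K i j \<ge> 0"
    and diag: "\<And>i. i \<in> I \<Longrightarrow> K i i > 0"
    and c: "\<And>i. i \<in> I \<Longrightarrow> c i > 0"
  shows "\<exists>x. (\<forall>i\<in>I. x i > 0) \<and>
    (\<forall>y. (\<forall>i\<in>I. y i > 0) \<longrightarrow> scaling_potential I K c x \<le> scaling_potential I K c y)"
proof -
  let ?F = "scaling_potential I K c"
  define g where "g i t = K i i / 2 * t\<^sup>2 - c i * ln t" for i t
  have "\<exists>m. \<forall>t>0. m \<le> g i t" if "i \<in> I" for i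
    unfolding g_def using quadratic_minus_ln_bounded_below[OF diag[OF that] c[OF that]] .
  then obtain m where m: "m i \<le> g i t" if "i \<in> I" "t > 0" for i t
    by metis
  define L where "L i = ?F (\<lambda>_. 1) - (\<Sum>j\<in>I - {i}. m j)" for i
  have "\<exists>lo hi. 0 < lo \<and> (\<forall>t>0. g i t \<le> L i \<longrightarrow> lo \<le> t \<and> t \<le> hi)" if "i \<in> I" for i
    unfolding g_def using quadratic_minus_ln_sublevel[OF diag[OF that] c[OF that]] .
  then obtain lo hi where lo: "\<And>i. i \<in> I \<Longrightarrow> lo i > 0"
      and sub: "\<And>i t. i \<in> I \<Longrightarrow> t > 0 \<Longrightarrow> g i t \<le> L i \<Longrightarrow> lo i \<le> t \<and> t \<le> hi i"
    by metis
  \<comment> \<open>Coordinates outside \<open>I\<close> are pinned to \<open>1\<close>, so that the box is compact in the full function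
      space.\<close>
  define box where "box = (\<Pi>\<^sub>E i\<in>UNIV. if i \<in> I then {lo i..hi i} else {1})"
  have "compactin (product_topology (\<lambda>_. euclidean) UNIV) box"
    unfolding box_def compactin_PiE by auto
  then have comp: "compact box"
    by (simp add: euclidean_product_topology)
  have box_pos: "x i > 0" if "x \<in> box" "i \<in> I" for x i
  proof -
    have "x i \<in> (if i \<in> I then {lo i..hi i} else {1})"
      using that(1) unfolding box_def by (rule PiE_mem) simp
    then show ?thesis
      using lo[OF that(2)] that(2) by simp
  qed
  have cont: "continuous_on box ?F"
  proof -
    have coord: "continuous_on box (\<lambda>x. x i)" for i
      by (rule continuous_on_subset[OF continuous_on_product_coordinates]) simp
    have "x i \<noteq> 0" if "x \<in> box" "i \<in> I" for x i
      using box_pos[OF that] by simp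
    then show ?thesis
      unfolding scaling_potential_def by (intro continuous_intros coord) simp_all
  qed
  have sublevel: "lo i \<le> x i \<and> x i \<le> hi i"
    if pos: "\<And>i. i \<in> I \<Longrightarrow> x i > 0" and le: "?F x \<le> ?F (\<lambda>_. 1)" and i: "i \<in> I" for x i
  proof -
    have "g i (x i) + (\<Sum>j\<in>I - {i}. m j) \<le> g i (x i) + (\<Sum>j\<in>I - {i}. g j (x j))"
      by (intro add_left_mono sum_mono m) (use pos in auto)
    also have "\<dots> = (\<Sum>j\<in>I. g j (x j))"
      by (rule sum.remove[OF fin i, symmetric])
    also have "\<dots> \<le> ?F x"
      unfolding g_def by (rule scaling_potential_ge_diagonal[OF fin nonneg pos])
    finally have "g i (x i) \<le> L i"
      using le unfolding L_def by linarith
    then show ?thesis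
      using sub[OF i pos[OF i]] by blast
  qed
  have one: "(\<lambda>_. 1) \<in> box"
    using sublevel[of "\<lambda>_. 1"] by (auto simp: box_def PiE_iff)
  obtain x where x: "x \<in> box" and min: "\<And>y. y \<in> box \<Longrightarrow> ?F x \<le> ?F y"
    using continuous_attains_inf[OF comp _ cont] one by blast
  have "?F x \<le> ?F y" if pos: "\<forall>i\<in>I. y i > 0" for y
  proof (cases "?F y \<le> ?F (\<lambda>_. 1)")
    case True
    define z where "z i = (if i \<in> I then y i else 1)" for i
    have "z \<in> box"
      using sublevel[of y] pos True by (auto simp: box_def PiE_iff z_def)
    moreover have "?F z = ?F y"
      by (simp add: scaling_potential_def z_def)
    ultimately show ?thesis
      using min by metis
  next
    case False
    then show ?thesis
      using min[OF one] by linarith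
  qed
  with box_pos[OF x] show ?thesis
    by blast
qed

text \<open>
  Symmetry of \<open>K\<close> merges the two contributions of the quadratic form to its partial derivative.
\<close>

lemma scaling_potential_partial_deriv:
  assumes fin: "finite I" and p: "p \<in> I"
    and sym: "\<And>i j. i \<in> I \<Longrightarrow> j \<in> I \<Longrightarrow> K i j = K j i"
    and pos: "\<And>i. i \<in> I \<Longrightarrow> x i > 0"
  shows "((\<lambda>t. scaling_potential I K c (x(p := t))) has_real_derivative
    (\<Sum>j\<in>I. K p j * x j) - c p / x p) (at (x p))"
proof -
  let ?d = "\<lambda>i. if i = p then 1 else 0 :: real"
  have coord: "((\<lambda>t. (x(p := t)) i) has_real_derivative ?d i) (at (x p))" for i
    by (cases "i = p") (auto intro!: derivative_eq_intros)
  have "((\<lambda>t. scaling_potential I K c (x(p := t))) has_real_derivative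
      (\<Sum>i\<in>I. \<Sum>j\<in>I. K i j * ?d i * x j + K i j * x i * ?d j) / 2 - (\<Sum>i\<in>I. c i * (?d i / x i)))
      (at (x p))"
    unfolding scaling_potential_def
  proof (intro DERIV_diff DERIV_cdivide DERIV_sum)
    fix i j assume "i \<in> I" "j \<in> I"
    show "((\<lambda>t. K i j * (x(p := t)) i * (x(p := t)) j) has_real_derivative
        K i j * ?d i * x j + K i j * x i * ?d j) (at (x p))"
      by (rule derivative_eq_intros coord refl)+ (simp add: algebra_simps)
  next
    fix i assume "i \<in> I"
    then show "((\<lambda>t. c i * ln ((x(p := t)) i)) has_real_derivative c i * (?d i / x i)) (at (x p))"
      using pos by (intro DERIV_cmult) (rule derivative_eq_intros coord refl | simp)+
  qed
  moreover have "(\<Sum>i\<in>I. \<Sum>j\<in>I. K i j * ?d i * x j) = (\<Sum>j\<in>I. K p j * x j)"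
  proof -
    have "(\<Sum>i\<in>I. \<Sum>j\<in>I. K i j * ?d i * x j) = (\<Sum>i\<in>I. if i = p then \<Sum>j\<in>I. K i j * x j else 0)"
      by (intro sum.cong) auto
    then show ?thesis
      using fin p by simp
  qed
  moreover have "(\<Sum>i\<in>I. \<Sum>j\<in>I. K i j * x i * ?d j) = (\<Sum>j\<in>I. K p j * x j)"
  proof -
    have "(\<Sum>i\<in>I. \<Sum>j\<in>I. K i j * x i * ?d j) = (\<Sum>i\<in>I. K i p * x i)"
      using fin p by (simp add: if_distrib[of "\<lambda>d. _ * d"] cong: if_cong)
    also have "\<dots> = (\<Sum>j\<in>I. K p j * x j)"
      by (rule sum.cong[OF refl]) (use sym p in metis)
    finally show ?thesis .
  qed
  moreover have "(\<Sum>i\<in>I. c i * (?d i / x i)) = c p / x p"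
  proof -
    have "(\<Sum>i\<in>I. c i * (?d i / x i)) = (\<Sum>i\<in>I. if i = p then c i / x i else 0)"
      by (intro sum.cong) auto
    then show ?thesis
      using fin p by simp
  qed
  ultimately show ?thesis
    by (simp add: sum.distrib)
qed

text \<open>
  At a minimizer of the potential all partial derivatives vanish, and this is the scaling
  equation.
\<close>

lemma ex_symmetric_scaling:
  fixes K :: "'a \<Rightarrow> 'a \<Rightarrow> real"
  assumes fin: "finite I"
    and sym: "\<And>i j. i \<in> I \<Longrightarrow> j \<in> I \<Longrightarrow> K i j = K j i"
    and nonneg: "\<And>i j. i \<in> I \<Longrightarrow> j \<in> I \<Longrightarrow> K i j \<ge> 0"
    and diag: "\<And>i. i \<in> I \<Longrightarrow> K i i > 0"
    and c: "\<And>i. i \<in> I \<Longrightarrow> c i > 0"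
  shows "\<exists>a. \<forall>i\<in>I. a i > 0 \<and> (\<Sum>j\<in>I. a i * a j * K i j) = c i"
proof -
  obtain a where pos: "\<And>i. i \<in> I \<Longrightarrow> a i > 0"
    and min: "\<And>y. \<forall>i\<in>I. y i > 0 \<Longrightarrow> scaling_potential I K c a \<le> scaling_potential I K c y"
    using scaling_potential_attains_min[of I K c] fin nonneg diag c by blast
  have "(\<Sum>j\<in>I. a i * a j * K i j) = c i" if i: "i \<in> I" for i
  proof -
    have "(\<Sum>j\<in>I. K i j * a j) - c i / a i = 0"
    proof (rule DERIV_local_min[OF scaling_potential_partial_deriv[OF fin i sym pos]])
      show "0 < a i"
        by (rule pos[OF i])
      show "\<forall>t. \<bar>a i - t\<bar> < a i \<longrightarrow>
          scaling_potential I K c (a(i := a i)) \<le> scaling_potential I K c (a(i := t))"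
      proof (intro allI impI)
        fix t assume "\<bar>a i - t\<bar> < a i"
        then have "t > 0"
          by linarith
        then show "scaling_potential I K c (a(i := a i)) \<le> scaling_potential I K c (a(i := t))"
          using min[of "a(i := t)"] pos by simp
      qed
    qed
    then have "a i * (\<Sum>j\<in>I. K i j * a j) = c i"
      using pos[OF i] by (simp add: field_simps)
    then show ?thesis
      by (simp add: sum_distrib_left mult_ac)
  qed
  with pos show ?thesis
    by blast
qed

section \<open>Gibbs' inequality\<close>

text \<open>
  The tangent line bound \<open>ln s \<le> s - 1\<close> at \<open>s = q / p\<close>, including the boundary value \<open>p = 0\<close>.
  The corrections \<open>p - q\<close> cancel when summed over two probability distributions, which makes
  Gibbs' inequality a termwise statement.
\<close>

lemma entropy_term_ge:
  fixes p q :: real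
  assumes "p \<ge> 0" "q > 0"
  shows "p - q \<le> (if p = 0 then 0 else p * ln (p / q))"
    and "(if p = 0 then 0 else p * ln (p / q)) = p - q \<Longrightarrow> p = q"
proof -
  have ln: "ln (q / p) \<le> q / p - 1" if "p > 0"
    using that assms by (intro ln_le_minus_one) simp
  have flip: "p * ln (p / q) = - (p * ln (q / p))" if "p > 0"
    using that assms by (simp add: ln_div algebra_simps)
  show "p - q \<le> (if p = 0 then 0 else p * ln (p / q))"
  proof (cases "p = 0")
    case False
    then have "p * ln (q / p) \<le> p * (q / p - 1)"
      using assms by (intro mult_left_mono ln) auto
    then show ?thesis
      using False assms flip by (simp add: algebra_simps)
  qed (use assms in simp)
  assume eq: "(if p = 0 then 0 else p * ln (p / q)) = p - q"
  have "p \<noteq> 0"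
    using eq assms by auto
  then have "p * ln (q / p) = p * (q / p - 1)"
    using eq assms flip by (simp add: algebra_simps)
  then have "ln (q / p) = q / p - 1"
    using \<open>p \<noteq> 0\<close> by simp
  then have "q / p = 1"
    using \<open>p \<noteq> 0\<close> assms by (intro ln_eq_minus_one) auto
  then show "p = q"
    using \<open>p \<noteq> 0\<close> by simp
qed

lemma gibbs_inequality:
  assumes fin: "finite \<Omega>" and P: "set_pmf P \<subseteq> \<Omega>" and R: "set_pmf R = \<Omega>"
  shows "rel_entropy \<Omega> P R \<ge> 0" and "rel_entropy \<Omega> P R = 0 \<longleftrightarrow> P = R"
proof -
  define e where "e \<omega> = (if pmf P \<omega> = 0 then 0 else pmf P \<omega> * ln (pmf P \<omega> / pmf R \<omega>))
      - (pmf P \<omega> - pmf R \<omega>)" for \<omega>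
  have R_pos: "pmf R \<omega> > 0" if "\<omega> \<in> \<Omega>" for \<omega>
    using that R by (simp add: pmf_positive)
  have e: "e \<omega> \<ge> 0" if "\<omega> \<in> \<Omega>" for \<omega>
    using entropy_term_ge(1)[OF pmf_nonneg R_pos[OF that], of P \<omega>] by (simp add: e_def)
  have "(\<Sum>\<omega>\<in>\<Omega>. pmf P \<omega>) = 1" "(\<Sum>\<omega>\<in>\<Omega>. pmf R \<omega>) = 1"
    using fin P R by (simp_all add: sum_pmf_eq_1)
  then have sum: "rel_entropy \<Omega> P R = (\<Sum>\<omega>\<in>\<Omega>. e \<omega>)"
    unfolding rel_entropy_def e_def sum_subtractf by simp
  show "rel_entropy \<Omega> P R \<ge> 0"
    unfolding sum by (rule sum_nonneg) (rule e)
  show "rel_entropy \<Omega> P R = 0 \<longleftrightarrow> P = R"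
  proof
    assume "rel_entropy \<Omega> P R = 0"
    then have zero: "e \<omega> = 0" if "\<omega> \<in> \<Omega>" for \<omega>
      using that unfolding sum by (simp add: sum_nonneg_eq_0_iff[OF fin e])
    show "P = R"
    proof (rule pmf_eqI)
      fix \<omega>
      show "pmf P \<omega> = pmf R \<omega>"
      proof (cases "\<omega> \<in> \<Omega>")
        case True
        then show ?thesis
          using zero[OF True] entropy_term_ge(2)[OF pmf_nonneg R_pos[OF True], of P \<omega>]
          by (simp add: e_def)
      next
        case False
        then show ?thesis
          using P R by (metis pmf_eq_0_set_pmf subsetD)
      qed
    qed
  qed (auto simp: rel_entropy_def intro!: sum.neutral)
qed

section \<open>Couplings of the uniform distribution\<close>

lemma expectation_coupling:
  fixes u v :: "'a \<Rightarrow> real"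
  assumes fin: "finite F" and P: "P \<in> uniform_couplings F"
  shows "(\<Sum>\<omega>\<in>F \<times> F. pmf P \<omega> * (u (fst \<omega>) + v (snd \<omega>))) =
    measure_pmf.expectation (pmf_of_set F) u + measure_pmf.expectation (pmf_of_set F) v"
proof -
  have sub: "set_pmf P \<subseteq> F \<times> F" and fst: "map_pmf fst P = pmf_of_set F"
    and snd: "map_pmf snd P = pmf_of_set F"
    using P by (auto simp: uniform_couplings_def)
  have exp: "measure_pmf.expectation P h = (\<Sum>\<omega>\<in>F \<times> F. pmf P \<omega> * h \<omega>)" for h :: "'a \<times> 'a \<Rightarrow> real"
    using sub fin by (subst integral_measure_pmf[of "F \<times> F"]) auto
  have "measure_pmf.expectation (pmf_of_set F) u = (\<Sum>\<omega>\<in>F \<times> F. pmf P \<omega> * u (fst \<omega>))"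
    unfolding fst[symmetric] integral_map_pmf exp ..
  moreover have "measure_pmf.expectation (pmf_of_set F) v = (\<Sum>\<omega>\<in>F \<times> F. pmf P \<omega> * v (snd \<omega>))"
    unfolding snd[symmetric] integral_map_pmf exp ..
  ultimately show ?thesis
    by (simp add: distrib_left sum.distrib)
qed

text \<open>
  The difference \<open>D(P,Q) - D(P,R)\<close> is the \<open>P\<close>-expectation of \<open>ln (R/Q)\<close>. As \<open>R/Q\<close> factorizes, this
  expectation sees only the marginals of \<open>P\<close>, so its value does not change when \<open>P\<close> is replaced
  by \<open>R\<close>.
\<close>

lemma rel_entropy_pythagoras:
  fixes u v :: "'a \<Rightarrow> real"
  assumes fin: "finite F"
    and P: "P \<in> uniform_couplings F" and R: "R \<in> uniform_couplings F"
    and Q: "\<And>A B. A \<in> F \<Longrightarrow> B \<in> F \<Longrightarrow> pmf Q (A, B) > 0"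
    and u: "\<And>A. A \<in> F \<Longrightarrow> u A > 0" and v: "\<And>A. A \<in> F \<Longrightarrow> v A > 0"
    and prod: "\<And>A B. A \<in> F \<Longrightarrow> B \<in> F \<Longrightarrow> pmf R (A, B) = u A * v B * pmf Q (A, B)"
  shows "rel_entropy (F \<times> F) P Q = rel_entropy (F \<times> F) P R + rel_entropy (F \<times> F) R Q"
proof -
  define w where "w \<omega> = ln (u (fst \<omega>)) + ln (v (snd \<omega>))" for \<omega>
  have split: "rel_entropy (F \<times> F) S Q = rel_entropy (F \<times> F) S R + (\<Sum>\<omega>\<in>F \<times> F. pmf S \<omega> * w \<omega>)" for S
    unfolding rel_entropy_def sum.distrib[symmetric]
  proof (rule sum.cong[OF refl])
    fix \<omega> assume "\<omega> \<in> F \<times> F"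
    then obtain A B where \<omega>: "\<omega> = (A, B)" and AB: "A \<in> F" "B \<in> F"
      by auto
    note pos = Q[OF AB] u[OF AB(1)] v[OF AB(2)]
    have "ln (pmf S (A, B) / pmf Q (A, B)) = ln (pmf S (A, B) / pmf R (A, B)) + w (A, B)"
      if "pmf S (A, B) \<noteq> 0"
    proof -
      have "pmf S (A, B) > 0"
        using that pmf_nonneg[of S "(A, B)"] by linarith
      then show ?thesis
        using pos by (simp add: prod[OF AB] w_def ln_div ln_mult)
    qed
    then show "(if pmf S \<omega> = 0 then 0 else pmf S \<omega> * ln (pmf S \<omega> / pmf Q \<omega>)) =
        (if pmf S \<omega> = 0 then 0 else pmf S \<omega> * ln (pmf S \<omega> / pmf R \<omega>)) + pmf S \<omega> * w \<omega>"
      by (simp add: \<omega> distrib_left)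
  qed
  have "(\<Sum>\<omega>\<in>F \<times> F. pmf P \<omega> * w \<omega>) = (\<Sum>\<omega>\<in>F \<times> F. pmf R \<omega> * w \<omega>)"
    unfolding w_def
    using expectation_coupling[OF fin P, of "\<lambda>A. ln (u A)" "\<lambda>B. ln (v B)"]
      expectation_coupling[OF fin R, of "\<lambda>A. ln (u A)" "\<lambda>B. ln (v B)"] by simp
  moreover have "rel_entropy (F \<times> F) R R = 0"
    by (auto simp: rel_entropy_def intro!: sum.neutral)
  ultimately show ?thesis
    using split[of P] split[of R] by simp
qed

corollary is_arg_min_rel_entropy_iff:
  fixes u v :: "'a \<Rightarrow> real"
  assumes fin: "finite F"
    and R: "R \<in> uniform_couplings F"
    and Q: "\<And>A B. A \<in> F \<Longrightarrow> B \<in> F \<Longrightarrow> pmf Q (A, B) > 0"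
    and u: "\<And>A. A \<in> F \<Longrightarrow> u A > 0" and v: "\<And>A. A \<in> F \<Longrightarrow> v A > 0"
    and prod: "\<And>A B. A \<in> F \<Longrightarrow> B \<in> F \<Longrightarrow> pmf R (A, B) = u A * v B * pmf Q (A, B)"
  shows "is_arg_min (\<lambda>P. rel_entropy (F \<times> F) P Q) (\<lambda>P. P \<in> uniform_couplings F) P \<longleftrightarrow> P = R"
proof -
  note pyth = rel_entropy_pythagoras[OF fin _ R Q u v prod]
  have "pmf R \<omega> > 0" if "\<omega> \<in> F \<times> F" for \<omega>
    using that Q u v prod by auto
  then have supp: "set_pmf R = F \<times> F"
    using R by (force simp: uniform_couplings_def set_pmf_iff)
  have gibbs: "rel_entropy (F \<times> F) S R \<ge> 0" "rel_entropy (F \<times> F) S R = 0 \<longleftrightarrow> S = R"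
    if "S \<in> uniform_couplings F" for S
    using gibbs_inequality[of "F \<times> F" S R] that fin supp by (auto simp: uniform_couplings_def)
  show ?thesis
  proof
    assume P: "is_arg_min (\<lambda>P. rel_entropy (F \<times> F) P Q) (\<lambda>P. P \<in> uniform_couplings F) P"
    then have "P \<in> uniform_couplings F" "rel_entropy (F \<times> F) P Q \<le> rel_entropy (F \<times> F) R Q"
      using R by (auto simp: is_arg_min_linorder)
    then show "P = R"
      using pyth[of P] gibbs[of P] by simp
  next
    have "rel_entropy (F \<times> F) R Q \<le> rel_entropy (F \<times> F) S Q" if "S \<in> uniform_couplings F" for S
      using pyth[OF that] gibbs(1)[OF that] by linarith
    moreover assume "P = R"
    ultimately show "is_arg_min (\<lambda>P. rel_entropy (F \<times> F) P Q) (\<lambda>P. P \<in> uniform_couplings F) P"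
      using R by (simp add: is_arg_min_linorder)
  qed
qed

lemma ex_uniform_coupling:
  fixes f :: "'a \<Rightarrow> 'a \<Rightarrow> real"
  assumes fin: "finite F" and ne: "F \<noteq> {}"
    and nonneg: "\<And>A B. A \<in> F \<Longrightarrow> B \<in> F \<Longrightarrow> f A B \<ge> 0"
    and row: "\<And>A. A \<in> F \<Longrightarrow> (\<Sum>B\<in>F. f A B) = 1 / card F"
    and col: "\<And>B. B \<in> F \<Longrightarrow> (\<Sum>A\<in>F. f A B) = 1 / card F"
  shows "\<exists>R \<in> uniform_couplings F. \<forall>A\<in>F. \<forall>B\<in>F. pmf R (A, B) = f A B"
proof -
  define g where "g \<omega> = (if \<omega> \<in> F \<times> F then f (fst \<omega>) (snd \<omega>) else 0)" for \<omega>
  define R where "R = embed_pmf g"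
  have g: "g \<omega> \<ge> 0" for \<omega>
    using nonneg by (auto simp: g_def)
  have "(\<Sum>\<omega>\<in>F \<times> F. g \<omega>) = (\<Sum>A\<in>F. \<Sum>B\<in>F. f A B)"
    unfolding sum.cartesian_product by (rule sum.cong) (auto simp: g_def)
  also have "\<dots> = 1"
    using row fin ne by simp
  finally have one: "(\<Sum>\<omega>\<in>F \<times> F. g \<omega>) = 1" .
  have "(\<integral>\<^sup>+ \<omega>. ennreal (g \<omega>) \<partial>count_space UNIV) = (\<Sum>\<omega>\<in>F \<times> F. ennreal (g \<omega>))"
    by (rule nn_integral_count_space') (use fin in \<open>auto simp: g_def\<close>)
  also have "\<dots> = 1"
    using g one by (simp add: sum_ennreal)
  finally have pmf_R: "pmf R \<omega> = g \<omega>" for \<omega>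
    unfolding R_def by (intro pmf_embed_pmf g)
  have sub: "set_pmf R \<subseteq> F \<times> F"
    by (auto simp: set_pmf_iff pmf_R g_def split: if_splits)
  have map: "pmf (map_pmf h R) x = (\<Sum>\<omega> \<in> {\<omega> \<in> F \<times> F. h \<omega> = x}. g \<omega>)" for h :: "'a \<times> 'a \<Rightarrow> 'a" and x
  proof -
    have "pmf (map_pmf h R) x = measure_pmf.prob R (h -` {x} \<inter> set_pmf R)"
      by (simp add: pmf_map measure_Int_set_pmf)
    also have "h -` {x} \<inter> set_pmf R = {\<omega> \<in> F \<times> F. h \<omega> = x} \<inter> set_pmf R"
      using sub by auto
    also have "measure_pmf.prob R \<dots> = (\<Sum>\<omega> \<in> {\<omega> \<in> F \<times> F. h \<omega> = x}. g \<omega>)"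
      using fin by (simp add: measure_Int_set_pmf measure_measure_pmf_finite pmf_R)
    finally show ?thesis .
  qed
  have "map_pmf fst R = pmf_of_set F"
  proof (rule pmf_eqI)
    fix A
    have "{\<omega> \<in> F \<times> F. fst \<omega> = A} = (if A \<in> F then Pair A ` F else {})"
      by auto
    then show "pmf (map_pmf fst R) A = pmf (pmf_of_set F) A"
      using fin ne row[of A] by (simp add: map sum.reindex inj_on_def g_def)
  qed
  moreover have "map_pmf snd R = pmf_of_set F"
  proof (rule pmf_eqI)
    fix B
    have "{\<omega> \<in> F \<times> F. snd \<omega> = B} = (if B \<in> F then (\<lambda>A. (A, B)) ` F else {})"
      by auto
    then show "pmf (map_pmf snd R) B = pmf (pmf_of_set F) B"
      using fin ne col[of B] by (simp add: map sum.reindex inj_on_def g_def)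
  qed
  ultimately have "R \<in> uniform_couplings F"
    using sub by (simp add: uniform_couplings_def)
  then show ?thesis
    by (intro bexI[of _ R]) (auto simp: pmf_R g_def)
qed

section \<open>The entropy minimizer for a union-closed family\<close>

theorem lemma10p1:
  fixes n :: nat and \<F> :: "nat set set"
  assumes "\<F> \<subseteq> Pow {1..n}" and "union_closed \<F>" and "card \<F> \<ge> 2"
  shows
    "(\<exists>!P. is_arg_min (\<lambda>P. rel_entropy (\<F> \<times> \<F>) P (union_ref \<F>)) (\<lambda>P. P \<in> uniform_couplings \<F>) P) \<and>
     (\<forall>P. is_arg_min (\<lambda>P. rel_entropy (\<F> \<times> \<F>) P (union_ref \<F>)) (\<lambda>P. P \<in> uniform_couplings \<F>) P \<longrightarrow>
        (\<forall>A\<in>\<F>. \<forall>B\<in>\<F>. pmf P (A, B) > 0) \<and>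
        (\<exists>a :: nat set \<Rightarrow> real.
           (\<forall>A\<in>\<F>. a A > 0) \<and>
           (\<forall>A\<in>\<F>. \<forall>B\<in>\<F>. pmf P (A, B) = a A * a B / real (reps \<F> (A \<union> B))) \<and>
           (\<forall>A\<in>\<F>. (\<Sum>B\<in>\<F>. a A * a B / real (reps \<F> (A \<union> B))) = 1 / real (card \<F>)) \<and>
           (\<forall>B\<in>\<F>. (\<Sum>A\<in>\<F>. a A * a B / real (reps \<F> (A \<union> B))) = 1 / real (card \<F>))))"
proof -
  let ?N = "real (card \<F>)"
  let ?r = "\<lambda>A B. real (reps \<F> (A \<union> B))"
  have fin: "finite \<F>"
    using assms(1) by (rule finite_subset) simp
  have ne: "\<F> \<noteq> {}"
    using assms(3) by auto
  have N: "?N > 0"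
    using fin ne by (simp add: card_gt_0_iff)
  have r: "?r A B > 0" if "A \<in> \<F>" "B \<in> \<F>" for A B
    using that assms(2) reps_pos[OF fin] by (auto simp: union_closed_def)
  have "\<exists>a. \<forall>A\<in>\<F>. a A > 0 \<and> (\<Sum>B\<in>\<F>. a A * a B * (1 / ?r A B)) = 1 / ?N"
  proof (rule ex_symmetric_scaling[OF fin])
    fix A assume "A \<in> \<F>"
    then show "1 / ?r A A > 0"
      using r[of A A] by simp
  qed (use N in \<open>simp_all add: Un_commute\<close>)
  then obtain a where a: "\<And>A. A \<in> \<F> \<Longrightarrow> a A > 0"
    and row: "\<And>A. A \<in> \<F> \<Longrightarrow> (\<Sum>B\<in>\<F>. a A * a B / ?r A B) = 1 / ?N"
    by auto
  have col: "(\<Sum>A\<in>\<F>. a A * a B / ?r A B) = 1 / ?N" if "B \<in> \<F>" for B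
    using row[OF that] by (simp add: mult.commute Un_commute)
  have "\<exists>R \<in> uniform_couplings \<F>. \<forall>A\<in>\<F>. \<forall>B\<in>\<F>. pmf R (A, B) = a A * a B / ?r A B"
    using a r by (intro ex_uniform_coupling[OF fin ne _ row col]) (auto simp: less_imp_le)
  then obtain R where R: "R \<in> uniform_couplings \<F>"
    and pmf_R: "\<And>A B. A \<in> \<F> \<Longrightarrow> B \<in> \<F> \<Longrightarrow> pmf R (A, B) = a A * a B / ?r A B"
    by blast
  note pmf_Q = pmf_union_ref[OF fin ne assms(2)]
  \<comment> \<open>The factor \<open>N\<close> in \<open>R/Q\<close> is absorbed into the function of the first coordinate.\<close>
  have iff: "is_arg_min (\<lambda>P. rel_entropy (\<F> \<times> \<F>) P (union_ref \<F>)) (\<lambda>P. P \<in> uniform_couplings \<F>) P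
      \<longleftrightarrow> P = R" for P
  proof (rule is_arg_min_rel_entropy_iff[OF fin R, where u = "\<lambda>A. ?N * a A" and v = a])
    fix A B assume "A \<in> \<F>" "B \<in> \<F>"
    then show "pmf (union_ref \<F>) (A, B) > 0"
      and "pmf R (A, B) = ?N * a A * a B * pmf (union_ref \<F>) (A, B)"
      using N r by (simp_all add: pmf_Q pmf_R)
  qed (use a N in auto)
  have pos: "pmf R (A, B) > 0" if "A \<in> \<F>" "B \<in> \<F>" for A B
    using that a r by (simp add: pmf_R)
  show ?thesis
    unfolding iff by (rule conjI, blast)
      (intro allI impI conjI exI[of _ a]; use a pmf_R row col pos in blast)
qed

end
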